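(* Let $(A,\sigma)$ be a state-morphism BL-algebra. Then $(A,\sigma)$ is semisimple if and only if $\mathrm{Rad}(A)\subseteq\mathrm{Ker}(\sigma)$.
   Context: A BL-algebra is an algebra $(A,\wedge,\vee,\odot,\to,0,1)$ of type $(2,2,2,2,0,0)$ such that $(A,\wedge,\vee,0,1)$ is a bounded lattice, $(A,\odot,1)$ is a commutative monoid, and for all $a,b,c\in A$: $c\le a\to b$ iff $a\odot c\le b$; $a\wedge b=a\odot(a\to b)$; $(a\to b)\vee(b\to a)=1$. A morphism-state-operator on $A$ is a map $\sigma:A\to A$ such that for all $x,y\in A$: $\sigma(0)=0$; $\sigma(x\to y)=\sigma(x)\to\sigma(x\wedge y)$; $\sigma(\sigma(x)\odot\sigma(y))=\sigma(x)\odot\sigma(y)$; $\sigma(\sigma(x)\to\sigma(y))=\sigma(x)\to\sigma(y)$; $\sigma(x\odot y)=\sigma(x)\odot\sigma(y)$; then $(A,\sigma)$ is a state-morphism BL-algebra. The image $\sigma(A)$ is a subalgebra of $A$, regarded as a BL-algebra. $\mathrm{Ker}(\sigma)=\{x\in A:\sigma(x)=1\}$. A filter is a nonempty subset closed under $\odot$ and upward closed; a maximal filter is a proper filter not strictly contained in another proper filter; $\mathrm{Rad}(B)$ is the intersection of all maximal filters of a BL-algebra $B$. A state BL-algebra $(A,\sigma)$ is semisimple if $\mathrm{Rad}(\sigma(A))=\{1\}$. *)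

theory Defs
  imports "HOL-Algebra.Group"
begin

text \<open>The signature extends the monoid record of \<^theory>\<open>HOL-Algebra.Group\<close>: the monoid
  product and unit play the roles of \<open>\<odot>\<close> and \<open>1\<close>. Structures are relativised to a
  carrier so that the image of a state operator is again a structure of the same kind.\<close>

record 'a bl = "'a monoid" +
  bl_meet :: "'a \<Rightarrow> 'a \<Rightarrow> 'a" (infixl \<open>\<curlywedge>\<index>\<close> 70)
  bl_join :: "'a \<Rightarrow> 'a \<Rightarrow> 'a" (infixl \<open>\<curlyvee>\<index>\<close> 65)
  bl_imp :: "'a \<Rightarrow> 'a \<Rightarrow> 'a" (infixr \<open>\<rightharpoondown>\<index>\<close> 60)
  bl_zero :: 'a (\<open>\<bbbO>\<index>\<close>)

definition bl_le :: "('a, 'b) bl_scheme \<Rightarrow> 'a \<Rightarrow> 'a \<Rightarrow> bool" (infix \<open>\<preceq>\<index>\<close> 50)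
  where "x \<preceq>\<^bsub>A\<^esub> y \<longleftrightarrow> x \<curlywedge>\<^bsub>A\<^esub> y = x"

locale bl_algebra = comm_monoid A for A :: "('a, 'b) bl_scheme" (structure) +
  assumes meet_closed: "\<lbrakk>x \<in> carrier A; y \<in> carrier A\<rbrakk> \<Longrightarrow> x \<curlywedge> y \<in> carrier A"
    and join_closed: "\<lbrakk>x \<in> carrier A; y \<in> carrier A\<rbrakk> \<Longrightarrow> x \<curlyvee> y \<in> carrier A"
    and imp_closed: "\<lbrakk>x \<in> carrier A; y \<in> carrier A\<rbrakk> \<Longrightarrow> x \<rightharpoondown> y \<in> carrier A"
    and zero_closed: "\<bbbO> \<in> carrier A"
    and meet_comm: "\<lbrakk>x \<in> carrier A; y \<in> carrier A\<rbrakk> \<Longrightarrow> x \<curlywedge> y = y \<curlywedge> x"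
    and join_comm: "\<lbrakk>x \<in> carrier A; y \<in> carrier A\<rbrakk> \<Longrightarrow> x \<curlyvee> y = y \<curlyvee> x"
    and meet_assoc: "\<lbrakk>x \<in> carrier A; y \<in> carrier A; z \<in> carrier A\<rbrakk>
      \<Longrightarrow> (x \<curlywedge> y) \<curlywedge> z = x \<curlywedge> (y \<curlywedge> z)"
    and join_assoc: "\<lbrakk>x \<in> carrier A; y \<in> carrier A; z \<in> carrier A\<rbrakk>
      \<Longrightarrow> (x \<curlyvee> y) \<curlyvee> z = x \<curlyvee> (y \<curlyvee> z)"
    and meet_absorb: "\<lbrakk>x \<in> carrier A; y \<in> carrier A\<rbrakk> \<Longrightarrow> x \<curlywedge> (x \<curlyvee> y) = x"
    and join_absorb: "\<lbrakk>x \<in> carrier A; y \<in> carrier A\<rbrakk> \<Longrightarrow> x \<curlyvee> (x \<curlywedge> y) = x"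
    and zero_least: "x \<in> carrier A \<Longrightarrow> \<bbbO> \<preceq> x"
    and one_greatest: "x \<in> carrier A \<Longrightarrow> x \<preceq> \<one>"
    and residuation: "\<lbrakk>a \<in> carrier A; b \<in> carrier A; c \<in> carrier A\<rbrakk>
      \<Longrightarrow> c \<preceq> (a \<rightharpoondown> b) \<longleftrightarrow> a \<otimes> c \<preceq> b"
    and divisibility: "\<lbrakk>a \<in> carrier A; b \<in> carrier A\<rbrakk> \<Longrightarrow> a \<curlywedge> b = a \<otimes> (a \<rightharpoondown> b)"
    and prelinearity: "\<lbrakk>a \<in> carrier A; b \<in> carrier A\<rbrakk> \<Longrightarrow> (a \<rightharpoondown> b) \<curlyvee> (b \<rightharpoondown> a) = \<one>"

locale state_morphism_bl_algebra = bl_algebra A for A :: "('a, 'b) bl_scheme" (structure) +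
  fixes \<sigma> :: "'a \<Rightarrow> 'a"
  assumes state_closed: "\<sigma> \<in> carrier A \<rightarrow> carrier A"
    and state_zero: "\<sigma> \<bbbO> = \<bbbO>"
    and state_imp: "\<lbrakk>x \<in> carrier A; y \<in> carrier A\<rbrakk> \<Longrightarrow> \<sigma> (x \<rightharpoondown> y) = \<sigma> x \<rightharpoondown> \<sigma> (x \<curlywedge> y)"
    and state_mult_image: "\<lbrakk>x \<in> carrier A; y \<in> carrier A\<rbrakk> \<Longrightarrow> \<sigma> (\<sigma> x \<otimes> \<sigma> y) = \<sigma> x \<otimes> \<sigma> y"
    and state_imp_image: "\<lbrakk>x \<in> carrier A; y \<in> carrier A\<rbrakk> \<Longrightarrow> \<sigma> (\<sigma> x \<rightharpoondown> \<sigma> y) = \<sigma> x \<rightharpoondown> \<sigma> y"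
    and state_mult: "\<lbrakk>x \<in> carrier A; y \<in> carrier A\<rbrakk> \<Longrightarrow> \<sigma> (x \<otimes> y) = \<sigma> x \<otimes> \<sigma> y"

definition bl_filter :: "('a, 'b) bl_scheme \<Rightarrow> 'a set \<Rightarrow> bool"
  where "bl_filter A F \<longleftrightarrow> F \<subseteq> carrier A \<and> F \<noteq> {}
    \<and> (\<forall>x\<in>F. \<forall>y\<in>F. x \<otimes>\<^bsub>A\<^esub> y \<in> F)
    \<and> (\<forall>x\<in>F. \<forall>y\<in>carrier A. x \<preceq>\<^bsub>A\<^esub> y \<longrightarrow> y \<in> F)"

definition bl_proper_filter :: "('a, 'b) bl_scheme \<Rightarrow> 'a set \<Rightarrow> bool"
  where "bl_proper_filter A F \<longleftrightarrow> bl_filter A F \<and> F \<noteq> carrier A"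

definition bl_maximal_filter :: "('a, 'b) bl_scheme \<Rightarrow> 'a set \<Rightarrow> bool"
  where "bl_maximal_filter A M \<longleftrightarrow>
    bl_proper_filter A M \<and> \<not> (\<exists>F. bl_proper_filter A F \<and> M \<subset> F)"

text \<open>The intersection is taken inside the carrier: the one-element algebra, which has no
  proper filters, is its own radical.\<close>

definition bl_Rad :: "('a, 'b) bl_scheme \<Rightarrow> 'a set"
  where "bl_Rad A = carrier A \<inter> \<Inter> {M. bl_maximal_filter A M}"

definition state_image :: "('a, 'b) bl_scheme \<Rightarrow> ('a \<Rightarrow> 'a) \<Rightarrow> ('a, 'b) bl_scheme"
  where "state_image A \<sigma> = A\<lparr>carrier := \<sigma> ` carrier A\<rparr>"

definition state_Ker :: "('a, 'b) bl_scheme \<Rightarrow> ('a \<Rightarrow> 'a) \<Rightarrow> 'a set"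
  where "state_Ker A \<sigma> = {x \<in> carrier A. \<sigma> x = \<one>\<^bsub>A\<^esub>}"

definition state_semisimple :: "('a, 'b) bl_scheme \<Rightarrow> ('a \<Rightarrow> 'a) \<Rightarrow> bool"
  where "state_semisimple A \<sigma> \<longleftrightarrow> bl_Rad (state_image A \<sigma>) = {\<one>\<^bsub>A\<^esub>}"

end

theory Submission
  imports Defs
begin

text \<open>An element \<open>x\<close> lies in every maximal filter iff each negated power
  \<open>x\<^sup>n \<rightharpoondown> 0\<close> is nilpotent. This condition only involves \<open>\<odot>\<close>, \<open>0\<close> and implications
  into \<open>0\<close>, all of which \<open>\<sigma>\<close> preserves; hence \<open>\<sigma>\<close> maps \<open>Rad A\<close> into \<open>Rad (\<sigma> A)\<close>, and
  \<open>Rad (\<sigma> A) = Rad A \<inter> \<sigma> A\<close>. Since \<open>\<sigma>\<close> is idempotent, both implications follow. Note that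
  \<open>\<sigma>\<close> need not preserve meets, so it cannot be treated as an endomorphism of \<open>A\<close>.\<close>

context bl_algebra
begin

section \<open>The lattice order\<close>

lemma le_trans:
  assumes "x \<in> carrier A" "y \<in> carrier A" "z \<in> carrier A" "x \<preceq> y" "y \<preceq> z"
  shows "x \<preceq> z"
  using assms meet_assoc[of x y z] by (simp add: bl_le_def)

lemma le_antisym:
  assumes "x \<in> carrier A" "y \<in> carrier A" "x \<preceq> y" "y \<preceq> x"
  shows "x = y"
  using assms meet_comm[of x y] by (simp add: bl_le_def)

lemma le_refl: "x \<in> carrier A \<Longrightarrow> x \<preceq> x"
  by (metis bl_le_def join_absorb join_closed meet_absorb meet_closed)

lemma meet_le1: "\<lbrakk>x \<in> carrier A; y \<in> carrier A\<rbrakk> \<Longrightarrow> x \<curlywedge> y \<preceq> x"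
  unfolding bl_le_def by (metis le_refl bl_le_def meet_assoc meet_closed meet_comm)

lemma meet_le2: "\<lbrakk>x \<in> carrier A; y \<in> carrier A\<rbrakk> \<Longrightarrow> x \<curlywedge> y \<preceq> y"
  using meet_le1[of y x] meet_comm[of x y] by simp

lemma le_meet:
  assumes "x \<in> carrier A" "y \<in> carrier A" "z \<in> carrier A" "z \<preceq> x" "z \<preceq> y"
  shows "z \<preceq> x \<curlywedge> y"
  using assms meet_assoc[of z x y] by (simp add: bl_le_def)

lemma le_join1: "\<lbrakk>x \<in> carrier A; y \<in> carrier A\<rbrakk> \<Longrightarrow> x \<preceq> x \<curlyvee> y"
  by (simp add: bl_le_def meet_absorb)

lemma le_join2: "\<lbrakk>x \<in> carrier A; y \<in> carrier A\<rbrakk> \<Longrightarrow> y \<preceq> x \<curlyvee> y"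
  using le_join1[of y x] join_comm[of x y] by simp

lemma join_eq_if_le: "\<lbrakk>x \<in> carrier A; y \<in> carrier A; x \<preceq> y\<rbrakk> \<Longrightarrow> x \<curlyvee> y = y"
  by (metis bl_le_def join_absorb join_comm meet_comm meet_closed)

lemma join_le:
  assumes "x \<in> carrier A" "y \<in> carrier A" "z \<in> carrier A" "x \<preceq> z" "y \<preceq> z"
  shows "x \<curlyvee> y \<preceq> z"
proof -
  have "(x \<curlyvee> y) \<curlyvee> z = z"
    using assms by (simp add: join_assoc join_eq_if_le)
  then show ?thesis
    using assms le_join1[of "x \<curlyvee> y" z] by (simp add: join_closed)
qed

section \<open>Residuation and the monoid product\<close>

lemma mult_mono_right:
  assumes "x \<in> carrier A" "y \<in> carrier A" "z \<in> carrier A" "x \<preceq> y"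
  shows "z \<otimes> x \<preceq> z \<otimes> y"
proof -
  \<comment> \<open>The unit of the adjunction given by \<open>residuation\<close>; transporting
    \<open>x \<preceq> y\<close> through it yields monotonicity.\<close>
  have "y \<preceq> z \<rightharpoondown> z \<otimes> y"
    using assms by (simp add: residuation le_refl)
  then have "x \<preceq> z \<rightharpoondown> z \<otimes> y"
    using assms le_trans[of x y] by (simp add: imp_closed)
  then show ?thesis
    using assms by (simp add: residuation)
qed

lemma mult_mono:
  assumes "x \<in> carrier A" "y \<in> carrier A" "u \<in> carrier A" "v \<in> carrier A"
    and "x \<preceq> y" "u \<preceq> v"
  shows "x \<otimes> u \<preceq> y \<otimes> v"
proof -
  have "x \<otimes> u \<preceq> x \<otimes> v"
    using assms by (simp add: mult_mono_right)
  moreover have "x \<otimes> v \<preceq> y \<otimes> v"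
    using assms mult_mono_right[of x y v] by (simp add: m_comm)
  ultimately show ?thesis
    using assms le_trans[of "x \<otimes> u" "x \<otimes> v"] by simp
qed

lemma mult_le1: "\<lbrakk>x \<in> carrier A; y \<in> carrier A\<rbrakk> \<Longrightarrow> x \<otimes> y \<preceq> x"
  using mult_mono_right[of y \<one> x] by (simp add: one_greatest)

lemma mult_imp_le: "\<lbrakk>x \<in> carrier A; y \<in> carrier A\<rbrakk> \<Longrightarrow> x \<otimes> (x \<rightharpoondown> y) \<preceq> y"
  using meet_le2[of x y] by (simp add: divisibility)

lemma le_zero: "\<lbrakk>x \<in> carrier A; x \<preceq> \<bbbO>\<rbrakk> \<Longrightarrow> x = \<bbbO>"
  by (simp add: le_antisym zero_least zero_closed)

lemma imp_self: "x \<in> carrier A \<Longrightarrow> x \<rightharpoondown> x = \<one>"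
  using residuation[of x x \<one>]
  by (simp add: le_antisym le_refl one_greatest imp_closed)

lemma le_imp_imp: "\<lbrakk>x \<in> carrier A; y \<in> carrier A\<rbrakk> \<Longrightarrow> x \<preceq> (x \<rightharpoondown> y) \<rightharpoondown> y"
  using mult_imp_le[of x y] by (simp add: residuation imp_closed m_comm)

lemma le_weaken_imp: "\<lbrakk>x \<in> carrier A; y \<in> carrier A\<rbrakk> \<Longrightarrow> x \<preceq> y \<rightharpoondown> x"
  using mult_le1[of x y] by (simp add: residuation m_comm)

text \<open>Makes joins expressible by implications and meets, which \<open>subalgebraI\<close>
  needs to get closure under joins.\<close>

lemma join_eq_meet_imp:
  assumes x: "x \<in> carrier A" and y: "y \<in> carrier A"
  shows "x \<curlyvee> y = ((x \<rightharpoondown> y) \<rightharpoondown> y) \<curlywedge> ((y \<rightharpoondown> x) \<rightharpoondown> x)" (is "_ = ?p \<curlywedge> ?q")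
proof (rule le_antisym)
  show j: "x \<curlyvee> y \<in> carrier A" and z: "?p \<curlywedge> ?q \<in> carrier A"
    using x y by (simp_all add: join_closed meet_closed imp_closed)
  have pq: "?p \<in> carrier A" "?q \<in> carrier A" and i: "x \<rightharpoondown> y \<in> carrier A" "y \<rightharpoondown> x \<in> carrier A"
    using x y by (simp_all add: imp_closed)
  show "x \<curlyvee> y \<preceq> ?p \<curlywedge> ?q"
    using x y pq by (simp add: join_le le_meet le_imp_imp le_weaken_imp imp_closed meet_closed)
  have "x \<rightharpoondown> y \<preceq> ?p \<curlywedge> ?q \<rightharpoondown> x \<curlyvee> y"
  proof -
    have "(x \<rightharpoondown> y) \<otimes> (?p \<curlywedge> ?q) \<preceq> y"
      using meet_le1[OF pq] residuation[OF i(1) y z] by blast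
    then show ?thesis
      using le_trans[OF _ y j _ le_join2[OF x y]] z i j by (simp add: residuation m_comm)
  qed
  moreover have "y \<rightharpoondown> x \<preceq> ?p \<curlywedge> ?q \<rightharpoondown> x \<curlyvee> y"
  proof -
    have "(y \<rightharpoondown> x) \<otimes> (?p \<curlywedge> ?q) \<preceq> x"
      using meet_le2[OF pq] residuation[OF i(2) x z] by blast
    then show ?thesis
      using le_trans[OF _ x j _ le_join1[OF x y]] z i j by (simp add: residuation m_comm)
  qed
  \<comment> \<open>Both \<open>x \<rightharpoondown> y\<close> and
    \<open>y \<rightharpoondown> x\<close> lie below this implication, and their join is
    \<open>\<one>\<close> by prelinearity.\<close>
  ultimately have "\<one> \<preceq> ?p \<curlywedge> ?q \<rightharpoondown> x \<curlyvee> y"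
    using join_le[OF i imp_closed[OF z j]] prelinearity[OF x y] by simp
  then show "?p \<curlywedge> ?q \<preceq> x \<curlyvee> y"
    using residuation[OF z j one_closed] z by simp
qed

section \<open>Filters and their maximal extensions\<close>

lemma proper_filter_iff: "bl_proper_filter A F \<longleftrightarrow> bl_filter A F \<and> \<bbbO> \<notin> F"
  unfolding bl_proper_filter_def bl_filter_def using zero_least zero_closed by blast

lemma filter_one: "bl_filter A F \<Longrightarrow> \<one> \<in> F"
  unfolding bl_filter_def using one_greatest by blast

lemma filter_pow:
  assumes "bl_filter A F" "x \<in> F"
  shows "x [^] (n::nat) \<in> F"
  using assms by (induction n) (auto simp: filter_one, auto simp: bl_filter_def)

text \<open>\<open>G\<close> is the filter generated by \<open>F\<close> and \<open>x\<close>: by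
  commutativity, a product of elements of \<open>F\<close> and copies of \<open>x\<close> collects
  into the form \<open>m \<otimes> x [^] n\<close>.\<close>

lemma filter_adjoin:
  assumes F: "bl_filter A F" and x: "x \<in> carrier A"
  defines "G \<equiv> {z \<in> carrier A. \<exists>m\<in>F. \<exists>n::nat. m \<otimes> x [^] n \<preceq> z}"
  shows "bl_filter A G" "F \<subseteq> G" "x \<in> G"
proof -
  have FA: "m \<in> carrier A" if "m \<in> F" for m
    using F that by (auto simp: bl_filter_def)
  show FG: "F \<subseteq> G"
  proof
    fix m assume m: "m \<in> F"
    then have "m \<otimes> x [^] (0::nat) \<preceq> m"
      by (simp add: FA le_refl)
    with m show "m \<in> G"
      unfolding G_def using FA by blast
  qed
  have "\<one> \<otimes> x [^] (1::nat) \<preceq> x"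
    using x by (simp add: le_refl)
  then show "x \<in> G"
    unfolding G_def using x filter_one[OF F] by blast
  show "bl_filter A G"
    unfolding bl_filter_def
  proof (intro conjI ballI impI)
    show "G \<subseteq> carrier A" by (auto simp: G_def)
    show "G \<noteq> {}" using FG filter_one[OF F] by auto
  next
    fix u v assume "u \<in> G" "v \<in> G"
    then obtain m n :: 'a and k l :: nat where
      m: "m \<in> F" "m \<otimes> x [^] k \<preceq> u" "u \<in> carrier A" and
      n: "n \<in> F" "n \<otimes> x [^] l \<preceq> v" "v \<in> carrier A"
      unfolding G_def by auto
    have "(m \<otimes> x [^] k) \<otimes> (n \<otimes> x [^] l) \<preceq> u \<otimes> v"
      using m n x by (simp add: mult_mono FA)
    moreover have "(m \<otimes> x [^] k) \<otimes> (n \<otimes> x [^] l) = (m \<otimes> n) \<otimes> x [^] (k + l)"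
      using m(1) n(1) x by (simp add: FA nat_pow_mult[symmetric] m_ac)
    moreover have "m \<otimes> n \<in> F"
      using F m(1) n(1) by (auto simp: bl_filter_def)
    ultimately show "u \<otimes> v \<in> G"
      unfolding G_def using m(3) n(3) by auto
  next
    fix u v assume "u \<in> G" and v: "v \<in> carrier A" "u \<preceq> v"
    then obtain m and k :: nat where "m \<in> F" "m \<otimes> x [^] k \<preceq> u" "u \<in> carrier A"
      unfolding G_def by auto
    then show "v \<in> G"
      unfolding G_def using v x le_trans[of "m \<otimes> x [^] k" u v] FA by auto
  qed
qed

lemma filter_singleton_one: "bl_filter A {\<one>}"
  unfolding bl_filter_def using le_antisym one_greatest by auto

text \<open>Zorn's lemma, applied to the proper filters above \<open>F\<close>.\<close>

lemma maximal_filter_extends: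
  assumes "bl_proper_filter A F"
  obtains M where "bl_maximal_filter A M" "F \<subseteq> M"
proof -
  let ?S = "{G. bl_proper_filter A G \<and> F \<subseteq> G}"
  have "\<exists>M\<in>?S. \<forall>X\<in>?S. M \<subseteq> X \<longrightarrow> X = M"
  proof (rule subset_Zorn_nonempty)
    show "?S \<noteq> {}" using assms by auto
  next
    fix C assume "C \<noteq> {}" and C: "subset.chain ?S C"
    then have fil: "\<And>G. G \<in> C \<Longrightarrow> bl_filter A G \<and> \<bbbO> \<notin> G \<and> F \<subseteq> G"
      by (auto simp: subset.chain_def proper_filter_iff)
    have "bl_filter A (\<Union>C)"
      unfolding bl_filter_def
    proof (intro conjI ballI impI)
      show "\<Union>C \<subseteq> carrier A" using fil unfolding bl_filter_def by blast
      show "\<Union>C \<noteq> {}" using fil \<open>C \<noteq> {}\<close> filter_one by blast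
    next
      fix x y assume "x \<in> \<Union>C" "y \<in> \<Union>C"
      then obtain X Y where XY: "x \<in> X" "y \<in> Y" "X \<in> C" "Y \<in> C" by blast
      \<comment> \<open>The larger of the two chain members contains both factors, hence their
        product.\<close>
      then have "X \<subseteq> Y \<or> Y \<subseteq> X"
        using C by (auto simp: subset_chain_def)
      then obtain Z where "Z \<in> C" "x \<in> Z" "y \<in> Z"
        using XY by blast
      then show "x \<otimes> y \<in> \<Union>C"
        using fil unfolding bl_filter_def by blast
    next
      fix x y assume "x \<in> \<Union>C" "y \<in> carrier A" "x \<preceq> y"
      then show "y \<in> \<Union>C"
        using fil unfolding bl_filter_def by blast
    qed
    \<comment> \<open>Properness, read as omission of \<open>\<bbbO>\<close>, passes to
      unions.\<close>
    then show "\<Union>C \<in> ?S"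
      using fil \<open>C \<noteq> {}\<close> by (auto simp: proper_filter_iff)
  qed
  then obtain M where M: "M \<in> ?S" and max: "\<forall>X\<in>?S. M \<subseteq> X \<longrightarrow> X = M"
    by (rule bexE)
  have "\<not> M \<subset> X" if "bl_proper_filter A X" for X
  proof
    assume "M \<subset> X"
    with M that have "X \<in> ?S" by auto
    with max \<open>M \<subset> X\<close> show False by auto
  qed
  with M have "bl_maximal_filter A M"
    unfolding bl_maximal_filter_def by auto
  moreover have "F \<subseteq> M"
    using M by simp
  ultimately show thesis
    by (rule that)
qed

section \<open>An elementwise description of the radical\<close>

lemma Rad_negated_power_nilpotent:
  assumes x: "x \<in> bl_Rad A"
  shows "\<exists>k::nat. (x [^] (n::nat) \<rightharpoondown> \<bbbO>) [^] k = \<bbbO>"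
proof (rule ccontr)
  assume nonnil: "\<nexists>k::nat. (x [^] n \<rightharpoondown> \<bbbO>) [^] k = \<bbbO>"
  let ?y = "x [^] n \<rightharpoondown> \<bbbO>"
  \<comment> \<open>The filter generated by \<open>?y\<close>, in the shape of
    \<open>filter_adjoin\<close> with base filter \<open>{\<one>}\<close>. If it contained
    \<open>\<bbbO>\<close>, some power of \<open>?y\<close> would be \<open>\<bbbO>\<close>.\<close>
  let ?G = "{z \<in> carrier A. \<exists>m\<in>{\<one>}. \<exists>k::nat. m \<otimes> ?y [^] k \<preceq> z}"
  have xA: "x \<in> carrier A"
    using x by (simp add: bl_Rad_def)
  then have yA: "?y \<in> carrier A"
    by (simp add: imp_closed zero_closed)
  note G = filter_adjoin[OF filter_singleton_one yA]
  have "\<bbbO> \<notin> ?G"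
    using nonnil yA le_zero by auto
  then have "bl_proper_filter A ?G"
    using G by (simp add: proper_filter_iff)
  then obtain M where M: "bl_maximal_filter A M" "?G \<subseteq> M"
    by (rule maximal_filter_extends)
  then have fil: "bl_filter A M" and "\<bbbO> \<notin> M"
    by (auto simp: bl_maximal_filter_def proper_filter_iff)
  \<comment> \<open>\<open>M\<close> contains a power of \<open>x\<close>, since \<open>x\<close> is
    in the radical, and also the negation of that power; their product is
    \<open>\<bbbO>\<close>.\<close>
  have "x [^] n \<in> M"
    using x M fil by (auto simp: bl_Rad_def intro: filter_pow)
  moreover have "?y \<in> M"
    using G M by blast
  ultimately have "x [^] n \<otimes> ?y \<in> M"
    using fil by (auto simp: bl_filter_def)
  moreover have "x [^] n \<otimes> ?y = \<bbbO>"
    using xA yA by (simp add: le_zero mult_imp_le zero_closed)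
  ultimately show False
    using \<open>\<bbbO> \<notin> M\<close> by simp
qed

text \<open>If a maximal filter \<open>M\<close> omits \<open>x\<close>, adjoining \<open>x\<close>
  produces \<open>\<bbbO>\<close>, so \<open>m \<otimes> x [^] n \<preceq> \<bbbO>\<close> for some
  \<open>m\<close> in \<open>M\<close>. Residuation puts
  \<open>x [^] n \<rightharpoondown> \<bbbO>\<close> into \<open>M\<close>, and nilpotency then puts
  \<open>\<bbbO>\<close> there.\<close>

lemma Rad_if_negated_powers_nilpotent:
  assumes x: "x \<in> carrier A"
    and nil: "\<And>n::nat. \<exists>k::nat. (x [^] n \<rightharpoondown> \<bbbO>) [^] k = \<bbbO>"
  shows "x \<in> bl_Rad A"
proof -
  have "x \<in> M" if M: "bl_maximal_filter A M" for M
  proof (rule ccontr)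
    assume "x \<notin> M"
    let ?G = "{z \<in> carrier A. \<exists>m\<in>M. \<exists>n::nat. m \<otimes> x [^] n \<preceq> z}"
    have fil: "bl_filter A M" and z: "\<bbbO> \<notin> M"
      using M by (auto simp: bl_maximal_filter_def proper_filter_iff)
    note G = filter_adjoin[OF fil x]
    have "M \<subset> ?G"
      using G(2,3) \<open>x \<notin> M\<close> by blast
    then have "\<bbbO> \<in> ?G"
      using M G(1) unfolding bl_maximal_filter_def proper_filter_iff by blast
    then obtain m and n :: nat where m: "m \<in> M" "m \<otimes> x [^] n \<preceq> \<bbbO>"
      by blast
    have mA: "m \<in> carrier A"
      using fil m by (auto simp: bl_filter_def)
    then have "m \<preceq> x [^] n \<rightharpoondown> \<bbbO>"
      using m x by (simp add: residuation zero_closed m_comm)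
    then have "x [^] n \<rightharpoondown> \<bbbO> \<in> M"
      using fil m x by (auto simp: bl_filter_def imp_closed zero_closed)
    then show False
      using nil[of n] filter_pow[OF fil] z by metis
  qed
  with x show ?thesis
    by (auto simp: bl_Rad_def)
qed

lemma mem_Rad_iff:
  "x \<in> bl_Rad A \<longleftrightarrow>
    x \<in> carrier A \<and> (\<forall>n::nat. \<exists>k::nat. (x [^] n \<rightharpoondown> \<bbbO>) [^] k = \<bbbO>)"
  using Rad_negated_power_nilpotent Rad_if_negated_powers_nilpotent
  by (auto simp: bl_Rad_def)

section \<open>Subalgebras\<close>

lemma subalgebraI:
  assumes H: "H \<subseteq> carrier A" and z: "\<bbbO> \<in> H" and one: "\<one> \<in> H"
    and mult: "\<And>x y. \<lbrakk>x \<in> H; y \<in> H\<rbrakk> \<Longrightarrow> x \<otimes> y \<in> H"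
    and imp: "\<And>x y. \<lbrakk>x \<in> H; y \<in> H\<rbrakk> \<Longrightarrow> x \<rightharpoondown> y \<in> H"
  shows "bl_algebra (A\<lparr>carrier := H\<rparr>)"
proof -
  have HA: "x \<in> carrier A" if "x \<in> H" for x
    using H that by blast
  \<comment> \<open>Divisibility writes meets through \<open>\<otimes>\<close> and
    \<open>\<rightharpoondown>\<close>; joins then follow from
    \<open>join_eq_meet_imp\<close>.\<close>
  have meet: "x \<curlywedge> y \<in> H" if "x \<in> H" "y \<in> H" for x y
    using that mult imp by (simp add: divisibility HA)
  have join: "x \<curlyvee> y \<in> H" if "x \<in> H" "y \<in> H" for x y
    using that meet imp by (simp add: join_eq_meet_imp HA)
  have le: "bl_le (A\<lparr>carrier := H\<rparr>) = bl_le A"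
    by (simp add: bl_le_def fun_eq_iff)
  show ?thesis
    \<comment> \<open>Apart from closure, every axiom is a universal statement about the same
      operations and order, so it restricts from \<open>carrier A\<close> to
      \<open>H\<close>.\<close>
    by (unfold_locales; simp add: le z one mult imp meet join;
        (rule m_assoc l_one r_one m_comm meet_comm join_comm meet_assoc join_assoc meet_absorb
          join_absorb zero_least one_greatest residuation divisibility prelinearity; rule HA)?)
qed

end

section \<open>State-morphism operators, their images and the radical\<close>

context state_morphism_bl_algebra
begin

lemma state_mem: "x \<in> carrier A \<Longrightarrow> \<sigma> x \<in> carrier A"
  using state_closed by blast

text \<open>Comes from \<open>\<one> = \<bbbO> \<rightharpoondown> \<bbbO>\<close> and
  \<open>\<sigma> \<bbbO> = \<bbbO>\<close>.\<close>

lemma state_one: "\<sigma> \<one> = \<one>"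
  using state_imp[of \<bbbO> \<bbbO>] zero_least[of \<bbbO>]
  by (simp add: zero_closed bl_le_def state_zero imp_self)

lemma state_idem: "x \<in> carrier A \<Longrightarrow> \<sigma> (\<sigma> x) = \<sigma> x"
  using state_mult_image[of x \<one>] by (simp add: state_one state_mem)

text \<open>The meet on the right of \<open>state_imp\<close> collapses to \<open>\<bbbO>\<close>
  when the target is \<open>\<bbbO>\<close>.\<close>

lemma state_neg: "x \<in> carrier A \<Longrightarrow> \<sigma> (x \<rightharpoondown> \<bbbO>) = \<sigma> x \<rightharpoondown> \<bbbO>"
  using state_imp[of x \<bbbO>] zero_least[of x] meet_comm[of x \<bbbO>]
  by (simp add: zero_closed bl_le_def state_zero)

lemma state_pow: "x \<in> carrier A \<Longrightarrow> \<sigma> (x [^] (n::nat)) = \<sigma> x [^] n"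
  by (induction n) (simp_all add: state_one state_mult)

lemma bl_algebra_state_image: "bl_algebra (state_image A \<sigma>)"
  unfolding state_image_def
proof (rule subalgebraI)
  show "\<sigma> ` carrier A \<subseteq> carrier A" using state_mem by blast
  show "\<bbbO> \<in> \<sigma> ` carrier A" by (rule image_eqI[of _ _ \<bbbO>]) (simp_all add: state_zero zero_closed)
  show "\<one> \<in> \<sigma> ` carrier A" by (rule image_eqI[of _ _ \<one>]) (simp_all add: state_one)
next
  fix x y assume "x \<in> \<sigma> ` carrier A" "y \<in> \<sigma> ` carrier A"
  then obtain u v where uv: "x = \<sigma> u" "y = \<sigma> v" "u \<in> carrier A" "v \<in> carrier A"
    by blast
  \<comment> \<open>Products and implications of image elements are fixed by
    \<open>\<sigma>\<close>, so each serves as its own preimage.\<close>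
  show "x \<otimes> y \<in> \<sigma> ` carrier A"
    by (rule image_eqI[of _ _ "x \<otimes> y"]) (simp_all add: uv state_mult_image state_mem)
  show "x \<rightharpoondown> y \<in> \<sigma> ` carrier A"
    by (rule image_eqI[of _ _ "x \<rightharpoondown> y"]) (simp_all add: uv state_imp_image state_mem imp_closed)
qed

text \<open>The nilpotency criterion applies to both algebras. Powers, implications and
  \<open>\<bbbO>\<close> do not depend on the carrier, so the two instances differ only in the
  membership condition.\<close>

lemma Rad_state_image: "bl_Rad (state_image A \<sigma>) = bl_Rad A \<inter> \<sigma> ` carrier A"
proof -
  have "x \<in> bl_Rad (state_image A \<sigma>) \<longleftrightarrow> x \<in> bl_Rad A \<and> x \<in> \<sigma> ` carrier A" for x
    unfolding mem_Rad_iff bl_algebra.mem_Rad_iff[OF bl_algebra_state_image]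
    using state_mem by (auto simp: state_image_def nat_pow_def)
  then show ?thesis by blast
qed

text \<open>Applying \<open>\<sigma>\<close> to the nilpotency equation for \<open>x\<close> gives
  the one for \<open>\<sigma> x\<close>, with the same exponent \<open>k\<close>.\<close>

lemma state_Rad:
  assumes "x \<in> bl_Rad A"
  shows "\<sigma> x \<in> bl_Rad A"
  unfolding mem_Rad_iff
proof (intro conjI allI)
  have x: "x \<in> carrier A"
    using assms by (simp add: mem_Rad_iff)
  then show "\<sigma> x \<in> carrier A"
    by (rule state_mem)
  fix n :: nat
  obtain k :: nat where k: "(x [^] n \<rightharpoondown> \<bbbO>) [^] k = \<bbbO>"
    using assms mem_Rad_iff by blast
  have "(\<sigma> x [^] n \<rightharpoondown> \<bbbO>) [^] k = \<sigma> ((x [^] n \<rightharpoondown> \<bbbO>) [^] k)"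
    using x by (simp add: state_pow state_neg imp_closed zero_closed)
  then show "\<exists>k::nat. (\<sigma> x [^] n \<rightharpoondown> \<bbbO>) [^] k = \<bbbO>"
    using k state_zero by auto
qed

lemma semisimple_iff_Rad_subset_Ker:
  "state_semisimple A \<sigma> \<longleftrightarrow> bl_Rad A \<subseteq> state_Ker A \<sigma>"
proof
  assume "state_semisimple A \<sigma>"
  then have R: "bl_Rad A \<inter> \<sigma> ` carrier A = {\<one>}"
    by (simp add: state_semisimple_def Rad_state_image)
  show "bl_Rad A \<subseteq> state_Ker A \<sigma>"
  proof
    fix x assume x: "x \<in> bl_Rad A"
    then have "x \<in> carrier A"
      by (simp add: mem_Rad_iff)
    \<comment> \<open>\<open>\<sigma> x\<close> lies both in the radical of \<open>A\<close> and in
      the image, hence equals \<open>\<one>\<close>.\<close>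
    with R state_Rad[OF x] show "x \<in> state_Ker A \<sigma>"
      by (auto simp: state_Ker_def)
  qed
next
  assume K: "bl_Rad A \<subseteq> state_Ker A \<sigma>"
  have "\<one> \<in> bl_Rad A"
    by (auto simp: bl_Rad_def bl_maximal_filter_def bl_proper_filter_def filter_one)
  moreover have "\<one> \<in> \<sigma> ` carrier A"
    by (rule image_eqI[of _ _ \<one>]) (simp_all add: state_one)
  \<comment> \<open>By idempotency \<open>\<sigma>\<close> fixes its image, so an image element in
    the kernel equals \<open>\<one>\<close>.\<close>
  moreover have "x = \<one>" if "x \<in> bl_Rad A" "x \<in> \<sigma> ` carrier A" for x
    using that K state_idem by (auto simp: state_Ker_def)
  ultimately have "bl_Rad A \<inter> \<sigma> ` carrier A = {\<one>}"
    by blast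
  then show "state_semisimple A \<sigma>"
    by (simp add: state_semisimple_def Rad_state_image)
qed

end

theorem theorem7p5:
  fixes A :: "('a, 'b) bl_scheme" and \<sigma> :: "'a \<Rightarrow> 'a"
  assumes "state_morphism_bl_algebra A \<sigma>"
  shows "state_semisimple A \<sigma> \<longleftrightarrow> bl_Rad A \<subseteq> state_Ker A \<sigma>"
  using assms by (rule state_morphism_bl_algebra.semisimple_iff_Rad_subset_Ker)

end
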